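(* Let $\Omega\subseteq\mathbb{C}$ be reflection-symmetric, modulus-closed, of pd-type, and such that $I:=\Omega\cap[0,\infty)$ is an interval. Then the following are equivalent for a function $f:\Omega\to\mathbb{C}$: (1) For every matrix $A\in M_2(\Omega)$ (Hermitian or not): $f[A]$ is positive definite if and only if $A$ is positive definite. (2) There exist real $\alpha,\beta>0$ such that $f(x)=\alpha\,\mathrm{sgn}(x)|x|^{\beta}$ for all $x\in\Omega\cap\mathbb{R}$, and $|f(z)|=\alpha|z|^{\beta}$ and $f(\overline{z})=\overline{f(z)}$ for all $z\in\Omega\setminus\mathbb{R}$; and moreover $f$ is injective and satisfies $f(\Omega\setminus\mathbb{R})\subseteq\mathbb{C}\setminus\mathbb{R}$. The result holds verbatim with "pd-type" replaced by "psd-type" and "definite" replaced by "semidefinite".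
   Context: $M_n(\Omega)$ denotes the set of all $n\times n$ matrices with entries in $\Omega$, and $f[A]:=(f(a_{ij}))$ for $A=(a_{ij})$. Positive (semi)definite matrices are Hermitian by definition, so a non-Hermitian matrix is not positive (semi)definite. $\mathrm{sgn}(0)=0$. A set $\Omega\subseteq\mathbb{C}$ is reflection-symmetric if $z\in\Omega$ implies $\overline{z}\in\Omega$, and modulus-closed if $z\in\Omega$ implies $|z|\in\Omega$. With $I:=\Omega\cap[0,\infty)$, $\Omega$ is of pd-type if for all $z\in\Omega\setminus I$ there exists $\epsilon>0$ such that $|z|+\epsilon\in I$; and of psd-type if for all $z\in\Omega\setminus I$ there exists $\delta>0$ such that $|z|-\delta\in I$. *)

theory Defs
  imports "HOL-Analysis.Analysis"
begin

definition reflection_symmetric :: "complex set \<Rightarrow> bool" where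
  "reflection_symmetric \<Omega> \<longleftrightarrow> (\<forall>z\<in>\<Omega>. cnj z \<in> \<Omega>)"

definition modulus_closed :: "complex set \<Rightarrow> bool" where
  "modulus_closed \<Omega> \<longleftrightarrow> (\<forall>z\<in>\<Omega>. complex_of_real (cmod z) \<in> \<Omega>)"

(* The set \<Omega> \<inter> [0,\<infinity>), as a set of reals. *)
definition nonneg_part :: "complex set \<Rightarrow> real set" where
  "nonneg_part \<Omega> = {r. 0 \<le> r \<and> complex_of_real r \<in> \<Omega>}"

definition pd_type :: "complex set \<Rightarrow> bool" where
  "pd_type \<Omega> \<longleftrightarrow>
     (\<forall>z \<in> \<Omega> - complex_of_real ` nonneg_part \<Omega>. \<exists>\<epsilon>>0. cmod z + \<epsilon> \<in> nonneg_part \<Omega>)"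

definition psd_type :: "complex set \<Rightarrow> bool" where
  "psd_type \<Omega> \<longleftrightarrow>
     (\<forall>z \<in> \<Omega> - complex_of_real ` nonneg_part \<Omega>. \<exists>\<delta>>0. cmod z - \<delta> \<in> nonneg_part \<Omega>)"

definition matrices_over :: "complex set \<Rightarrow> (complex^'n^'n) set" where
  "matrices_over \<Omega> = {A. \<forall>i j. A $ i $ j \<in> \<Omega>}"

definition hermitian :: "complex^'n^'n \<Rightarrow> bool" where
  "hermitian A \<longleftrightarrow> map_matrix cnj (transpose A) = A"

definition quadratic_form :: "complex^'n^'n \<Rightarrow> complex^'n \<Rightarrow> complex" where
  "quadratic_form A v = (\<Sum>i\<in>UNIV. cnj (v $ i) * (A *v v) $ i)"

(* The quadratic form of a Hermitian matrix is real-valued, so taking Re loses nothing. *)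

definition positive_definite :: "complex^'n^'n \<Rightarrow> bool" where
  "positive_definite A \<longleftrightarrow> hermitian A \<and> (\<forall>v. v \<noteq> 0 \<longrightarrow> 0 < Re (quadratic_form A v))"

definition positive_semidefinite :: "complex^'n^'n \<Rightarrow> bool" where
  "positive_semidefinite A \<longleftrightarrow> hermitian A \<and> (\<forall>v. 0 \<le> Re (quadratic_form A v))"

(* A function \<Omega> \<rightarrow> \<complex> is a total function of which only the values on \<Omega> are used. *)
definition signed_power_like :: "complex set \<Rightarrow> (complex \<Rightarrow> complex) \<Rightarrow> bool" where
  "signed_power_like \<Omega> f \<longleftrightarrow>
     (\<exists>\<alpha> \<beta>::real. \<alpha> > 0 \<and> \<beta> > 0 \<and>
        (\<forall>x::real. complex_of_real x \<in> \<Omega> \<longrightarrow>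
           f (complex_of_real x) = complex_of_real (\<alpha> * sgn x * \<bar>x\<bar> powr \<beta>)) \<and>
        (\<forall>z \<in> \<Omega> - \<real>. cmod (f z) = \<alpha> * cmod z powr \<beta> \<and> f (cnj z) = cnj (f z)))
     \<and> inj_on f \<Omega> \<and> f ` (\<Omega> - \<real>) \<subseteq> - \<real>"

end

theory Submission
  imports Defs
begin

text \<open>
  A \<open>2 \<times> 2\<close> matrix with diagonal \<open>p, q\<close> and off-diagonal \<open>z, w\<close> is positive definite iff
  \<open>p, q > 0\<close>, \<open>w = cnj z\<close> and \<open>\<bar>z\<bar>\<^sup>2 < p q\<close>. Testing \<open>f\<close> on such matrices therefore compares
  \<open>\<bar>f z\<bar>\<^sup>2\<close> with \<open>f p * f q\<close> according to the order of \<open>\<bar>z\<bar>\<^sup>2\<close> and \<open>p q\<close>. For real \<open>z > 0\<close>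
  this says that \<open>g = ln \<circ> f \<circ> exp\<close> satisfies the midpoint inequalities
  \<open>2 g y \<le> g p + g q\<close> for \<open>2 y < p + q\<close> and the reverse for \<open>2 y > p + q\<close>, which force \<open>g\<close> to be
  affine: \<open>f\<close> is a power law on the positive reals. Squeezing then gives \<open>\<bar>f z\<bar>\<close> for every other
  \<open>z\<close>. Finally \<open>f z = f w\<close> makes the matrix with diagonal \<open>q, q\<close> and off-diagonal \<open>z, cnj w\<close>
  have a positive (semi)definite image, so it is Hermitian and \<open>z = w\<close>. This injectivity also
  accounts for the sign on the negative reals and for nonreal points having nonreal images.
\<close>

section \<open>Strict midpoint inequalities and affine functions\<close>

text \<open>Subtracting the chord of \<open>g\<close> leaves a function \<open>h\<close> that
  vanishes at both ends and satisfies the same inequality up to \<open>c * (p + q - 2 * y)\<close>,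
  which can be made arbitrarily small. Boundedness makes the supremum \<open>M\<close> of
  \<open>h\<close> finite, and then \<open>M \<le> M / 2\<close>, so \<open>h\<close> is nowhere
  positive.\<close>

lemma midpoint_upper_bound:
  fixes g :: "real \<Rightarrow> real"
  assumes st: "s < t" and bdd: "bdd_above (g ` {s..t})"
    and mid: "\<And>p q y. \<lbrakk>p \<in> {s..t}; q \<in> {s..t}; y \<in> {s..t}; 2 * y < p + q\<rbrakk> \<Longrightarrow> 2 * g y \<le> g p + g q"
    and x: "x \<in> {s..t}"
  shows "(t - s) * g x \<le> (t - x) * g s + (x - s) * g t"
proof -
  define c where "c = (g t - g s) / (t - s)"
  define h where "h = (\<lambda>u. g u - g s - c * (u - s))"
  have ct: "c * (t - s) = g t - g s" using st by (simp add: c_def)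
  have hs: "h s = 0" by (simp add: h_def)
  have ht: "h t = 0" using ct by (simp add: h_def)
  have hmid: "2 * h y \<le> h p + h q + c * (p + q - 2 * y)"
    if "p \<in> {s..t}" "q \<in> {s..t}" "y \<in> {s..t}" "2 * y < p + q" for p q y
    using mid[OF that] by (simp add: h_def algebra_simps)
  obtain B where B: "g u \<le> B" if "u \<in> {s..t}" for u
    using bdd unfolding bdd_above_def by blast
  have hB: "h u \<le> B - g s + \<bar>c\<bar> * (t - s)" if "u \<in> {s..t}" for u
  proof -
    have "- (c * (u - s)) \<le> \<bar>c\<bar> * (u - s)"
      using that by (metis abs_ge_minus_self atLeastAtMost_iff diff_ge_0_iff_ge minus_mult_left mult_right_mono)
    also have "\<dots> \<le> \<bar>c\<bar> * (t - s)" using that by (intro mult_left_mono) auto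
    finally show ?thesis using B[OF that] by (simp add: h_def)
  qed
  then have hbdd: "bdd_above (h ` {s..t})" by (rule bdd_aboveI2)
  define M where "M = (SUP u\<in>{s..t}. h u)"
  have hM: "h u \<le> M" if "u \<in> {s..t}" for u
    unfolding M_def using hbdd that by (rule cSUP_upper2) auto
  have M0: "0 \<le> M" using hM[of s] hs st by simp
  \<comment> \<open>\<open>u\<close> is almost the midpoint of two points of the segment one of which is an end point, where
    \<open>h\<close> vanishes. The strict inequality in the hypothesis is what costs the extra \<open>e\<close>.\<close>
  have half: "h u \<le> M / 2" if u: "u \<in> {s..t}" for u
  proof (cases "u = s \<or> u = t")
    case True
    then show ?thesis using hs ht M0 by auto
  next
    case False
    then have u': "s < u" "u < t" using u by auto
    define d where "d = min (u - s) (t - u)"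
    have d: "0 < d" using u' by (simp add: d_def)
    have near: "2 * h u \<le> M + c * e" if e: "0 < e" "e < d" for e
    proof (cases "2 * u \<le> s + t - e")
      case True
      have "2 * h u \<le> h s + h (2 * u - s + e) + c * (s + (2 * u - s + e) - 2 * u)"
        by (rule hmid) (use True u' e in auto)
      moreover have "h (2 * u - s + e) \<le> M" by (rule hM) (use True u' e in auto)
      ultimately show ?thesis using hs by simp
    next
      case False
      have "2 * h u \<le> h (2 * u - t + e) + h t + c * ((2 * u - t + e) + t - 2 * u)"
        by (rule hmid) (use False u' e in \<open>auto simp: d_def\<close>)
      moreover have "h (2 * u - t + e) \<le> M" by (rule hM) (use False u' e in \<open>auto simp: d_def\<close>)
      ultimately show ?thesis using ht by simp
    qed
    have "((\<lambda>e. M + c * e) \<longlongrightarrow> M + c * 0) (at_right 0)"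
      by (intro tendsto_intros)
    moreover have "eventually (\<lambda>e. 2 * h u \<le> M + c * e) (at_right 0)"
      using d near by (auto simp: eventually_at_right_field)
    ultimately have "2 * h u \<le> M + c * 0"
      by (intro tendsto_lowerbound[of _ _ "at_right 0"]) auto
    then show ?thesis by simp
  qed
  have "M \<le> M / 2"
    unfolding M_def by (rule cSUP_least) (use st half M_def in auto)
  then have "h x \<le> 0" using half[OF x] by simp
  then have "(t - s) * g x \<le> (t - s) * (g s + c * (x - s))"
    using st by (intro mult_left_mono) (auto simp: h_def)
  also have "\<dots> = (t - s) * g s + (c * (t - s)) * (x - s)" by (simp add: algebra_simps)
  also have "\<dots> = (t - x) * g s + (x - s) * g t" unfolding ct by (simp add: algebra_simps)
  finally show ?thesis .
qed

text \<open>The lower bound is the upper bound for \<open>- g (- u)\<close> on the reflected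
  segment. Reflecting values and argument together turns \<open>mid2\<close> into the form of
  \<open>mid1\<close>, strict inequality included. Boundedness comes from monotonicity, which is
  \<open>mid1\<close> with \<open>p = q\<close>.\<close>

lemma midpoint_affine_segment:
  fixes g :: "real \<Rightarrow> real"
  assumes st: "s < t"
    and mid1: "\<And>p q y. \<lbrakk>p \<in> {s..t}; q \<in> {s..t}; y \<in> {s..t}; 2 * y < p + q\<rbrakk> \<Longrightarrow> 2 * g y \<le> g p + g q"
    and mid2: "\<And>p q y. \<lbrakk>p \<in> {s..t}; q \<in> {s..t}; y \<in> {s..t}; p + q < 2 * y\<rbrakk> \<Longrightarrow> g p + g q \<le> 2 * g y"
    and x: "x \<in> {s..t}"
  shows "(t - s) * g x = (t - x) * g s + (x - s) * g t"
proof (rule antisym)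
  have mono: "g p \<le> g q" if "p \<in> {s..t}" "q \<in> {s..t}" "p \<le> q" for p q
    using mid1[of q q p] that by (cases "p = q") auto
  have "bdd_above (g ` {s..t})"
    by (rule bdd_aboveI[of _ "g t"]) (use mono st in auto)
  from midpoint_upper_bound[OF st this mid1 x]
  show "(t - s) * g x \<le> (t - x) * g s + (x - s) * g t" .
  have bdd: "bdd_above ((\<lambda>u. - g (- u)) ` {-t..-s})"
    by (rule bdd_aboveI[of _ "- g s"]) (use mono st in auto)
  have "(- s - (- t)) * (- g (- (- x))) \<le> (- s - (- x)) * (- g (- (- t))) + (- x - (- t)) * (- g (- (- s)))"
  proof (rule midpoint_upper_bound[OF _ bdd, of "- x"])
    fix p q y assume "p \<in> {-t..-s}" "q \<in> {-t..-s}" "y \<in> {-t..-s}" "2 * y < p + q"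
    then show "2 * - g (- y) \<le> - g (- p) + - g (- q)"
      using mid2[of "-p" "-q" "-y"] by auto
  qed (use st x in auto)
  then show "(t - x) * g s + (x - s) * g t \<le> (t - s) * g x"
    by (simp add: algebra_simps)
qed

text \<open>The identity says that three points of the graph are collinear. For \<open>x\<close>
  outside \<open>{s..t}\<close> it therefore follows from the segment spanned by \<open>x\<close>
  and the farther of \<open>s\<close> and \<open>t\<close>, with the nearer one as inner
  point.\<close>

lemma midpoint_affine:
  fixes g :: "real \<Rightarrow> real"
  assumes J: "is_interval J" and s: "s \<in> J" and t: "t \<in> J" and st: "s < t"
    and mid1: "\<And>p q y. \<lbrakk>p \<in> J; q \<in> J; y \<in> J; 2 * y < p + q\<rbrakk> \<Longrightarrow> 2 * g y \<le> g p + g q"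
    and mid2: "\<And>p q y. \<lbrakk>p \<in> J; q \<in> J; y \<in> J; p + q < 2 * y\<rbrakk> \<Longrightarrow> g p + g q \<le> 2 * g y"
    and x: "x \<in> J"
  shows "(t - s) * g x = (t - x) * g s + (x - s) * g t"
proof -
  have seg: "{a..b} \<subseteq> J" if "a \<in> J" "b \<in> J" for a b
    using J that unfolding is_interval_1 by (meson atLeastAtMost_iff subsetI)
  have three: "(b - a) * g u = (b - u) * g a + (u - a) * g b"
    if "a \<in> J" "b \<in> J" "a < b" "a \<le> u" "u \<le> b" for a b u
    by (rule midpoint_affine_segment)
      (use that subsetD[OF seg[OF that(1,2)]] in \<open>(blast intro: mid1 mid2 | simp)+\<close>)
  consider "x < s" | "s \<le> x" "x \<le> t" | "t < x" by linarith
  then show ?thesis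
  proof cases
    case 1
    then show ?thesis using three[of x t s] s t x st by (simp add: algebra_simps)
  next
    case 2
    then show ?thesis using three[of s t x] s t st by simp
  next
    case 3
    then show ?thesis using three[of s x t] s x st by (simp add: algebra_simps)
  qed
qed

section \<open>Power laws on intervals of positive reals\<close>

text \<open>In logarithmic coordinates, comparing \<open>y\<^sup>2\<close> with \<open>p * q\<close>
  becomes comparing \<open>2 * y\<close> with \<open>p + q\<close>, so \<open>g\<close> is affine.
  Its slope is \<open>\<beta>\<close>, positive because \<open>F s < F t\<close>, and
  \<open>\<alpha>\<close> is the exponential of its value at 0.\<close>

lemma power_law:
  fixes F :: "real \<Rightarrow> real"
  assumes I: "is_interval I" and I0: "I \<subseteq> {0<..}"
    and s: "s \<in> I" and t: "t \<in> I" and st: "s < t" and F_st: "F s < F t"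
    and pos: "\<And>x. x \<in> I \<Longrightarrow> 0 < F x"
    and mid1: "\<And>p q y. \<lbrakk>p \<in> I; q \<in> I; y \<in> I; y\<^sup>2 < p * q\<rbrakk> \<Longrightarrow> (F y)\<^sup>2 \<le> F p * F q"
    and mid2: "\<And>p q y. \<lbrakk>p \<in> I; q \<in> I; y \<in> I; p * q < y\<^sup>2\<rbrakk> \<Longrightarrow> F p * F q \<le> (F y)\<^sup>2"
  obtains \<alpha> \<beta> where "0 < \<alpha>" "0 < \<beta>" "\<And>x. x \<in> I \<Longrightarrow> F x = \<alpha> * x powr \<beta>"
proof -
  define J where "J = {u. exp u \<in> I}"
  define g where "g = (\<lambda>u. ln (F (exp u)))"
  have J: "is_interval J"
    using I unfolding J_def is_interval_1 by (metis exp_le_cancel_iff mem_Collect_eq)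
  have lnJ: "ln x \<in> J" if "x \<in> I" for x using that I0 by (auto simp: J_def)
  have sq: "(exp y)\<^sup>2 = exp (2 * y)" for y :: real
    by (simp add: exp_double)
  have g_exp: "F (exp u) = exp (g u)" if "u \<in> J" for u
    using pos[of "exp u"] that by (simp add: g_def J_def)
  have aff: "(ln t - ln s) * g u = (ln t - u) * g (ln s) + (u - ln s) * g (ln t)"
    if u: "u \<in> J" for u
  proof (rule midpoint_affine[OF J lnJ[OF s] lnJ[OF t] _ _ _ u])
    show "ln s < ln t" using s t st I0 by auto
  next
    fix p q y assume a: "p \<in> J" "q \<in> J" "y \<in> J" "2 * y < p + q"
    have "(F (exp y))\<^sup>2 \<le> F (exp p) * F (exp q)"
      by (rule mid1) (use a in \<open>auto simp: J_def sq simp flip: exp_add\<close>)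
    then show "2 * g y \<le> g p + g q"
      using a by (simp add: g_exp sq flip: exp_add)
  next
    fix p q y assume a: "p \<in> J" "q \<in> J" "y \<in> J" "p + q < 2 * y"
    have "F (exp p) * F (exp q) \<le> (F (exp y))\<^sup>2"
      by (rule mid2) (use a in \<open>auto simp: J_def sq simp flip: exp_add\<close>)
    then show "g p + g q \<le> 2 * g y"
      using a by (simp add: g_exp sq flip: exp_add)
  qed
  define \<beta> where "\<beta> = (g (ln t) - g (ln s)) / (ln t - ln s)"
  define \<alpha> where "\<alpha> = exp (g (ln s) - \<beta> * ln s)"
  have lst: "ln s < ln t" using s t st I0 by auto
  have "g (ln s) < g (ln t)"
    using F_st s t I0 pos[OF s] pos[OF t] by (auto simp: g_def subset_iff)
  then have \<beta>: "0 < \<beta>" using lst by (simp add: \<beta>_def)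
  have gx: "g u = g (ln s) + \<beta> * (u - ln s)" if "u \<in> J" for u
    using aff[OF that] lst by (simp add: \<beta>_def field_simps)
  have "F x = \<alpha> * x powr \<beta>" if x: "x \<in> I" for x
  proof -
    have x0: "0 < x" using x I0 by auto
    have "F x = exp (g (ln x))" using g_exp[OF lnJ[OF x]] x0 by simp
    also have "\<dots> = exp ((g (ln s) - \<beta> * ln s) + \<beta> * ln x)"
      by (subst gx[OF lnJ[OF x]]) (simp add: algebra_simps)
    also have "\<dots> = \<alpha> * x powr \<beta>" unfolding exp_add \<alpha>_def using x0 by (simp add: powr_def)
    finally show ?thesis .
  qed
  then show ?thesis using that[of \<alpha> \<beta>] \<beta> by (simp add: \<alpha>_def)
qed

text \<open>Right continuity of the power function carries a bound at points just above
  \<open>r\<close> to \<open>r\<close> itself. The case \<open>r = 0\<close> is included, where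
  continuity relies on \<open>0 < \<beta>\<close>.\<close>

lemma powr_bound_right:
  fixes \<beta> :: real
  assumes "0 < \<beta>" "0 \<le> r" "r < R" and le: "\<And>q. \<lbrakk>r < q; q < R\<rbrakk> \<Longrightarrow> c \<le> \<alpha> * q powr \<beta>"
  shows "c \<le> \<alpha> * r powr \<beta>"
proof -
  have "((\<lambda>q. \<alpha> * q powr \<beta>) \<longlongrightarrow> \<alpha> * r powr \<beta>) (at_right r)"
    using assms(1,2)
    by (intro tendsto_mult tendsto_powr' tendsto_const tendsto_ident_at)
      (auto simp: eventually_at_right_field intro!: exI[of _ "r + 1"])
  moreover have "eventually (\<lambda>q. c \<le> \<alpha> * q powr \<beta>) (at_right r)"
    using assms by (auto simp: eventually_at_right_field)
  ultimately show ?thesis by (intro tendsto_lowerbound[of _ _ "at_right r"]) auto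
qed

lemma powr_bound_left:
  fixes \<beta> :: real
  assumes "R < r" "0 < r" and le: "\<And>q. \<lbrakk>R < q; q < r\<rbrakk> \<Longrightarrow> \<alpha> * q powr \<beta> \<le> c"
  shows "\<alpha> * r powr \<beta> \<le> c"
proof -
  have "((\<lambda>q. \<alpha> * q powr \<beta>) \<longlongrightarrow> \<alpha> * r powr \<beta>) (at_left r)"
    using assms(2) by (intro tendsto_intros) auto
  moreover have "eventually (\<lambda>q. \<alpha> * q powr \<beta> \<le> c) (at_left r)"
    using assms by (auto simp: eventually_at_left_field)
  ultimately show ?thesis by (intro tendsto_upperbound[of _ _ "at_left r"]) auto
qed

section \<open>Definiteness of 2 x 2 matrices by their entries\<close>

text \<open>The arguments are the entries read row by row. The real diagonal and
  \<open>c = cnj b\<close> express that the matrix is Hermitian; the rest is the condition on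
  principal minors.\<close>

definition pd2 :: "complex \<Rightarrow> complex \<Rightarrow> complex \<Rightarrow> complex \<Rightarrow> bool" where
  "pd2 a b c d \<longleftrightarrow> a \<in> \<real> \<and> d \<in> \<real> \<and> 0 < Re a \<and> 0 < Re d \<and> c = cnj b \<and> (cmod b)\<^sup>2 < Re a * Re d"

definition psd2 :: "complex \<Rightarrow> complex \<Rightarrow> complex \<Rightarrow> complex \<Rightarrow> bool" where
  "psd2 a b c d \<longleftrightarrow> a \<in> \<real> \<and> d \<in> \<real> \<and> 0 \<le> Re a \<and> 0 \<le> Re d \<and> c = cnj b \<and> (cmod b)\<^sup>2 \<le> Re a * Re d"

lemma hermitian_2:
  fixes A :: "complex^2^2"
  shows "hermitian A \<longleftrightarrow> A$1$1 \<in> \<real> \<and> A$2$2 \<in> \<real> \<and> A$2$1 = cnj (A$1$2)"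
  unfolding hermitian_def map_matrix_def transpose_def Reals_cnj_iff
  by (auto simp: vec_eq_iff forall_2)

lemma Re_quadratic_form_2:
  fixes A :: "complex^2^2"
  assumes "A$2$1 = cnj (A$1$2)"
  shows "Re (quadratic_form A v) =
    Re (A$1$1) * (cmod (v$1))\<^sup>2 + Re (A$2$2) * (cmod (v$2))\<^sup>2 + 2 * Re (cnj (v$1) * A$1$2 * v$2)"
  using assms unfolding quadratic_form_def matrix_vector_mult_def cmod_power2
  by (simp add: sum_2 algebra_simps power2_eq_square)

text \<open>Completing the square, multiplied through by \<open>a\<close> to avoid a
  division.\<close>

lemma hermitian_form_complete_square:
  fixes b x y :: complex and a d :: real
  shows "a * (a * (cmod x)\<^sup>2 + d * (cmod y)\<^sup>2 + 2 * Re (cnj x * b * y))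
    = (cmod (of_real a * x + b * y))\<^sup>2 + (a * d - (cmod b)\<^sup>2) * (cmod y)\<^sup>2"
  unfolding cmod_power2 by (simp add: algebra_simps power2_eq_square)

text \<open>Test vectors give necessity, the completed square gives sufficiency. In the semidefinite
  case \<open>a = 0\<close> needs its own argument, since the completed square carries the factor
  \<open>a\<close>.\<close>

lemma definiteness_2:
  fixes A :: "complex^2^2"
  shows "(positive_definite A \<longleftrightarrow> pd2 (A$1$1) (A$1$2) (A$2$1) (A$2$2)) \<and>
    (positive_semidefinite A \<longleftrightarrow> psd2 (A$1$1) (A$1$2) (A$2$1) (A$2$2))"
proof (cases "hermitian A")
  case False
  then show ?thesis
    by (simp add: positive_definite_def positive_semidefinite_def pd2_def psd2_def hermitian_2) blast
next
  case True
  define a b d where "a = Re (A$1$1)" and "b = A$1$2" and "d = Re (A$2$2)"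
  define Q where "Q = (\<lambda>x y. a * (cmod x)\<^sup>2 + d * (cmod y)\<^sup>2 + 2 * Re (cnj x * b * y))"
  have sym: "A$2$1 = cnj (A$1$2)" using True by (simp add: hermitian_2)
  have "positive_definite A \<longleftrightarrow> (\<forall>v::complex^2. v \<noteq> 0 \<longrightarrow> 0 < Q (v$1) (v$2))"
    using True by (simp add: positive_definite_def Re_quadratic_form_2[OF sym] Q_def a_def b_def d_def)
  also have "\<dots> \<longleftrightarrow> (\<forall>x y. x \<noteq> 0 \<or> y \<noteq> 0 \<longrightarrow> 0 < Q x y)"
    by (simp add: vec_eq_iff forall_2 forall_vector_2)
  also have "\<dots> \<longleftrightarrow> 0 < a \<and> 0 < d \<and> (cmod b)\<^sup>2 < a * d"
  proof (intro iffI conjI allI impI; (elim conjE)?)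
    assume Q: "\<forall>x y. x \<noteq> 0 \<or> y \<noteq> 0 \<longrightarrow> 0 < Q x y"
    have a: "0 < a" using Q[rule_format, of 1 0] by (simp add: Q_def)
    then show "0 < a" .
    show "0 < d" using Q[rule_format, of 0 1] by (simp add: Q_def)
    \<comment> \<open>The vector \<open>(- b, a)\<close> annihilates the square and isolates the
      determinant.\<close>
    have "0 < a * Q (- b) (of_real a)" using Q a by simp
    also have "\<dots> = (a * d - (cmod b)\<^sup>2) * a\<^sup>2"
      unfolding Q_def hermitian_form_complete_square by (simp add: algebra_simps)
    finally show "(cmod b)\<^sup>2 < a * d" using a by (simp add: zero_less_mult_iff)
  next
    fix x y :: complex
    assume a: "0 < a" "0 < d" "(cmod b)\<^sup>2 < a * d" and xy: "x \<noteq> 0 \<or> y \<noteq> 0"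
    have "0 < a * Q x y"
    proof (cases "y = 0")
      case True
      then show ?thesis using xy a by (simp add: Q_def)
    next
      case False
      then have "0 < (a * d - (cmod b)\<^sup>2) * (cmod y)\<^sup>2" using a by simp
      then show ?thesis unfolding Q_def hermitian_form_complete_square
        by (simp add: add_nonneg_pos)
    qed
    then show "0 < Q x y" using a by (simp add: zero_less_mult_iff)
  qed
  also have "\<dots> \<longleftrightarrow> pd2 (A$1$1) (A$1$2) (A$2$1) (A$2$2)"
    using True by (auto simp: pd2_def hermitian_2 a_def b_def d_def)
  finally have pd: "positive_definite A \<longleftrightarrow> pd2 (A$1$1) (A$1$2) (A$2$1) (A$2$2)" .
  have "positive_semidefinite A \<longleftrightarrow> (\<forall>v::complex^2. 0 \<le> Q (v$1) (v$2))"
    using True by (simp add: positive_semidefinite_def Re_quadratic_form_2[OF sym] Q_def a_def b_def d_def)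
  also have "\<dots> \<longleftrightarrow> (\<forall>x y. 0 \<le> Q x y)"
    by (simp add: forall_vector_2)
  also have "\<dots> \<longleftrightarrow> 0 \<le> a \<and> 0 \<le> d \<and> (cmod b)\<^sup>2 \<le> a * d"
  proof safe
    assume Q: "\<forall>x y. 0 \<le> Q x y"
    show a: "0 \<le> a" using Q[rule_format, of 1 0] by (simp add: Q_def)
    show d: "0 \<le> d" using Q[rule_format, of 0 1] by (simp add: Q_def)
    show "(cmod b)\<^sup>2 \<le> a * d"
    proof (cases "a = 0")
      case True
      \<comment> \<open>If \<open>b\<close> were nonzero, the form would be linear in
        \<open>e\<close> along the vectors \<open>(- e * b, 1)\<close>; this \<open>e\<close> pushes
        its value down to \<open>- d - 2 < 0\<close>.\<close>
      define e where "e = (d + 1) / (cmod b)\<^sup>2"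
      have "Q (- of_real e * b) 1 = d - 2 * e * (cmod b)\<^sup>2"
        using True unfolding Q_def cmod_power2 by (simp add: algebra_simps power2_eq_square)
      moreover have "\<dots> = - d - 2" if "b \<noteq> 0" using that by (simp add: e_def)
      ultimately have "b = 0" using Q[rule_format, of "- of_real e * b" 1] d by force
      then show ?thesis using True by simp
    next
      case False
      have "0 \<le> a * Q (- b) (of_real a)" using Q a by simp
      also have "\<dots> = (a * d - (cmod b)\<^sup>2) * a\<^sup>2"
        unfolding Q_def hermitian_form_complete_square by (simp add: algebra_simps)
      finally show ?thesis using a False by (simp add: zero_le_mult_iff)
    qed
  next
    fix x y :: complex
    assume a: "0 \<le> a" "0 \<le> d" "(cmod b)\<^sup>2 \<le> a * d"
    show "0 \<le> Q x y"
    proof (cases "a = 0")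
      case True
      then show ?thesis using a by (simp add: Q_def)
    next
      case False
      have "0 \<le> a * Q x y"
        unfolding Q_def hermitian_form_complete_square using a by simp
      then show ?thesis using a False by (simp add: zero_le_mult_iff)
    qed
  qed
  also have "\<dots> \<longleftrightarrow> psd2 (A$1$1) (A$1$2) (A$2$1) (A$2$2)"
    using True by (auto simp: psd2_def hermitian_2 a_def b_def d_def)
  finally have "positive_semidefinite A \<longleftrightarrow> psd2 (A$1$1) (A$1$2) (A$2$1) (A$2$2)" .
  with pd show ?thesis by blast
qed

lemma ball_matrices_over_2:
  "(\<forall>A \<in> (matrices_over \<Omega> :: (complex^2^2) set). P (A$1$1) (A$1$2) (A$2$1) (A$2$2)) \<longleftrightarrow>
   (\<forall>a\<in>\<Omega>. \<forall>b\<in>\<Omega>. \<forall>c\<in>\<Omega>. \<forall>d\<in>\<Omega>. P a b c d)"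
proof safe
  fix a b c d
  assume *: "\<forall>A \<in> (matrices_over \<Omega> :: (complex^2^2) set). P (A$1$1) (A$1$2) (A$2$1) (A$2$2)"
    and "a \<in> \<Omega>" "b \<in> \<Omega>" "c \<in> \<Omega>" "d \<in> \<Omega>"
  then have "vector [vector [a, b], vector [c, d]] \<in> (matrices_over \<Omega> :: (complex^2^2) set)"
    by (simp add: matrices_over_def forall_2)
  from bspec[OF * this] show "P a b c d" by simp
qed (simp add: matrices_over_def)

section \<open>An equivalent form of the signed power condition\<close>

text \<open>Working form of \<open>signed_power_like\<close>: the modulus and conjugation laws range
  over all of \<open>\<Omega>\<close>, while the sign on the negative reals and the nonreal images
  are left to injectivity.\<close>

definition injective_power_law :: "complex set \<Rightarrow> (complex \<Rightarrow> complex) \<Rightarrow> bool" where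
  "injective_power_law \<Omega> f \<longleftrightarrow>
    (\<exists>\<alpha> \<beta>::real. 0 < \<alpha> \<and> 0 < \<beta> \<and>
       (\<forall>r\<in>nonneg_part \<Omega>. f (of_real r) = of_real (\<alpha> * r powr \<beta>)) \<and>
       (\<forall>z\<in>\<Omega>. cmod (f z) = \<alpha> * cmod z powr \<beta> \<and> f (cnj z) = cnj (f z))) \<and> inj_on f \<Omega>"

text \<open>For negative \<open>x\<close>, the conjugation law makes \<open>f x\<close> real, with
  the modulus of \<open>f (- x)\<close>; injectivity excludes equality and leaves the negative sign.
  A real value at a nonreal \<open>z\<close> would give \<open>f (cnj z) = f z\<close>, against
  injectivity.\<close>

lemma signed_power_like_iff:
  assumes refl: "reflection_symmetric \<Omega>" and modc: "modulus_closed \<Omega>"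
  shows "signed_power_like \<Omega> f \<longleftrightarrow> injective_power_law \<Omega> f"
proof
  assume "signed_power_like \<Omega> f"
  then obtain \<alpha> \<beta> :: real where ab: "0 < \<alpha>" "0 < \<beta>"
    and re: "\<And>x::real. of_real x \<in> \<Omega> \<Longrightarrow> f (of_real x) = of_real (\<alpha> * sgn x * \<bar>x\<bar> powr \<beta>)"
    and nr: "\<And>z. z \<in> \<Omega> - \<real> \<Longrightarrow> cmod (f z) = \<alpha> * cmod z powr \<beta> \<and> f (cnj z) = cnj (f z)"
    and inj: "inj_on f \<Omega>"
    unfolding signed_power_like_def by (elim exE conjE) (rule that, simp_all)
  have "cmod (f z) = \<alpha> * cmod z powr \<beta> \<and> f (cnj z) = cnj (f z)" if z: "z \<in> \<Omega>" for z
  proof (cases "z \<in> \<real>")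
    case True
    then obtain x where x: "z = of_real x" by (auto elim: Reals_cases)
    then show ?thesis using re[of x] z ab
      by (cases "x = 0") (auto simp: norm_mult abs_mult abs_sgn_eq simp del: of_real_mult)
  qed (use nr z in auto)
  moreover have "f (of_real r) = of_real (\<alpha> * r powr \<beta>)" if "r \<in> nonneg_part \<Omega>" for r
    using re[of r] that by (cases "r = 0") (auto simp: nonneg_part_def)
  ultimately show "injective_power_law \<Omega> f"
    unfolding injective_power_law_def using ab inj by blast
next
  assume "injective_power_law \<Omega> f"
  then obtain \<alpha> \<beta> :: real where ab: "0 < \<alpha>" "0 < \<beta>"
    and pos: "\<And>r. r \<in> nonneg_part \<Omega> \<Longrightarrow> f (of_real r) = of_real (\<alpha> * r powr \<beta>)"
    and md: "\<And>z. z \<in> \<Omega> \<Longrightarrow> cmod (f z) = \<alpha> * cmod z powr \<beta>"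
    and cj: "\<And>z. z \<in> \<Omega> \<Longrightarrow> f (cnj z) = cnj (f z)"
    and inj: "inj_on f \<Omega>"
    unfolding injective_power_law_def by blast
  have "f (of_real x) = of_real (\<alpha> * sgn x * \<bar>x\<bar> powr \<beta>)" if x: "of_real x \<in> \<Omega>" for x :: real
  proof (cases "0 \<le> x")
    case True
    then show ?thesis using pos[of x] x by (cases "x = 0") (auto simp: nonneg_part_def)
  next
    case False
    then have "of_real (- x) \<in> \<Omega>"
      using modc x by (force simp: modulus_closed_def)
    then have f': "f (of_real (- x)) = of_real (\<alpha> * (- x) powr \<beta>)"
      using pos[of "- x"] False by (simp add: nonneg_part_def)
    have "f (of_real x) \<in> \<real>" using cj[OF x] by (simp add: Reals_cnj_iff)
    then obtain y where y: "f (of_real x) = of_real y" by (auto elim: Reals_cases)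
    have "\<bar>y\<bar> = \<alpha> * (- x) powr \<beta>" using md[OF x] y False by simp
    moreover have "y \<noteq> \<alpha> * (- x) powr \<beta>"
    proof
      assume "y = \<alpha> * (- x) powr \<beta>"
      then have "f (of_real x) = f (of_real (- x))" using y f' by simp
      then have "complex_of_real x = of_real (- x)"
        using inj x \<open>of_real (- x) \<in> \<Omega>\<close> by (blast dest: inj_onD)
      then have "x = - x" by (simp only: of_real_eq_iff)
      then show False using False by simp
    qed
    ultimately have "y = - (\<alpha> * (- x) powr \<beta>)" by linarith
    then show ?thesis using y False by simp
  qed
  moreover have "f z \<notin> \<real>" if z: "z \<in> \<Omega>" "z \<notin> \<real>" for z
  proof
    assume "f z \<in> \<real>"
    then have "f (cnj z) = f z" using cj[OF z(1)] by (simp add: Reals_cnj_iff)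
    moreover have "cnj z \<in> \<Omega>" using refl z by (simp add: reflection_symmetric_def)
    ultimately have "cnj z = z" using inj z by (blast dest: inj_onD)
    then show False using z by (simp add: Reals_cnj_iff)
  qed
  ultimately show "signed_power_like \<Omega> f"
    unfolding signed_power_like_def using ab md cj inj by blast
qed

section \<open>From preservers to injective power laws\<close>

lemma modulus_in_nonneg_part:
  assumes "modulus_closed \<Omega>" "z \<in> \<Omega>"
  shows "cmod z \<in> nonneg_part \<Omega>"
  using assms by (simp add: modulus_closed_def nonneg_part_def)

lemma injective_power_law_empty: "injective_power_law {} f"
  unfolding injective_power_law_def by (auto simp: nonneg_part_def intro: exI[of _ 1])

text \<open>The smaller of two distinct points may be 0, but their midpoint is positive.\<close>

lemma ex_two_positive:
  fixes I :: "real set"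
  assumes "is_interval I" "\<not> is_singleton I" "I \<noteq> {}" "I \<subseteq> {0..}"
  obtains s t where "s \<in> I" "t \<in> I" "0 < s" "s < t"
proof -
  obtain u v where uv: "u \<in> I" "v \<in> I" "u < v"
    using assms(2,3) by (metis antisym_conv3 ex_in_conv is_singletonI')
  then have "u \<le> (u + v) / 2" "(u + v) / 2 \<le> v" by auto
  with uv have "(u + v) / 2 \<in> I" using assms(1) unfolding is_interval_1 by blast
  then show ?thesis using that[of "(u + v) / 2" v] uv assms(4) by force
qed

text \<open>
  Both preserver problems satisfy these hypotheses. The disjunction in \<open>off\<close> is the only place where
  they differ: the first alternative comes from pd-type, the second from psd-type.
\<close>

lemma injective_power_lawI:
  fixes f :: "complex \<Rightarrow> complex"
  defines "F \<equiv> \<lambda>x::real. Re (f (of_real x))"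
  assumes modc: "modulus_closed \<Omega>"
    and intv: "is_interval I" and I: "I = nonneg_part \<Omega>"
    and st: "s \<in> I" "t \<in> I" "0 < s" "s < t"
    and pos: "\<And>x. \<lbrakk>x \<in> I; 0 < x\<rbrakk> \<Longrightarrow> 0 < F x"
    and strict: "F s < F t"
    and cj: "\<And>z. z \<in> \<Omega> \<Longrightarrow> f (cnj z) = cnj (f z)"
    and upper: "\<And>p q z. \<lbrakk>p \<in> I; q \<in> I; 0 < p; 0 < q; z \<in> \<Omega>; (cmod z)\<^sup>2 < p * q\<rbrakk> \<Longrightarrow> (cmod (f z))\<^sup>2 \<le> F p * F q"
    and lower: "\<And>p q z. \<lbrakk>p \<in> I; q \<in> I; 0 < p; 0 < q; z \<in> \<Omega>; p * q < (cmod z)\<^sup>2\<rbrakk> \<Longrightarrow> F p * F q \<le> (cmod (f z))\<^sup>2"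
    and off: "\<And>z. z \<in> \<Omega> - of_real ` I \<Longrightarrow>
      (F (cmod z) \<le> cmod (f z) \<and> (\<exists>q\<in>I. cmod z < q)) \<or> (cmod (f z) \<le> F (cmod z) \<and> (\<exists>q\<in>I. q < cmod z))"
    and inj: "\<And>z w. \<lbrakk>z \<in> \<Omega>; w \<in> \<Omega>; cmod z = cmod w; f z = f w\<rbrakk> \<Longrightarrow> z = w"
  shows "injective_power_law \<Omega> f"
proof -
  have inI: "x \<in> I \<longleftrightarrow> 0 \<le> x \<and> complex_of_real x \<in> \<Omega>" for x by (simp add: I nonneg_part_def)
  have fF: "f (of_real x) = of_real (F x)" if "x \<in> I" for x
    using cj[of "of_real x"] that by (auto simp: F_def inI complex_eq_iff)
  have between: "x \<in> I" if "a \<in> I" "b \<in> I" "a \<le> x" "x \<le> b" for a b x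
    using intv that unfolding is_interval_1 by blast
  define Ip where "Ip = I \<inter> {0<..}"
  have normF: "(cmod (f (of_real y)))\<^sup>2 = (F y)\<^sup>2" if "y \<in> I" for y
    using fF[OF that] by simp
  obtain \<alpha> \<beta> where ab: "0 < \<alpha>" "0 < \<beta>" and pow: "\<And>x. x \<in> Ip \<Longrightarrow> F x = \<alpha> * x powr \<beta>"
  proof (rule power_law[of Ip s t F])
    show "is_interval Ip"
      unfolding Ip_def by (rule is_interval_Int[OF intv]) (auto simp: is_interval_1)
    fix p q y assume pqy: "p \<in> Ip" "q \<in> Ip" "y \<in> Ip"
    then have y: "y \<in> I" "of_real y \<in> \<Omega>" by (auto simp: Ip_def inI)
    show "(F y)\<^sup>2 \<le> F p * F q" if "y\<^sup>2 < p * q"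
      using upper[of p q "of_real y"] pqy y normF[OF y(1)] that by (simp add: Ip_def)
    show "F p * F q \<le> (F y)\<^sup>2" if "p * q < y\<^sup>2"
      using lower[of p q "of_real y"] pqy y normF[OF y(1)] that by (simp add: Ip_def)
  qed (use st strict pos in \<open>auto simp: Ip_def\<close>)
  \<comment> \<open>Diagonal \<open>p, p\<close> with \<open>p\<close> slightly above
    \<open>cmod z\<close> bounds \<open>cmod (f z)\<close> by \<open>F p\<close>; then
    \<open>p\<close> decreases to \<open>cmod z\<close>. The bound \<open>low\<close> approaches
    from below instead.\<close>
  have up: "cmod (f z) \<le> \<alpha> * cmod z powr \<beta>" if z: "z \<in> \<Omega>" and q: "q \<in> I" "cmod z < q" for z q
  proof (rule powr_bound_right[OF ab(2) norm_ge_zero q(2)])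
    fix p assume p: "cmod z < p" "p < q"
    have "cmod z \<in> I" using modulus_in_nonneg_part[OF modc z] I by simp
    then have "p \<in> I" using between[of "cmod z" q p] q p by simp
    moreover have p0: "0 < p" using p norm_ge_zero[of z] by linarith
    moreover have "(cmod z)\<^sup>2 < p * p"
      using p by (simp add: power2_eq_square mult_strict_mono')
    ultimately have "(cmod (f z))\<^sup>2 \<le> (F p)\<^sup>2" "0 < F p"
      using upper[of p p z] z pos by (auto simp: power2_eq_square)
    then show "cmod (f z) \<le> \<alpha> * p powr \<beta>"
      using pow[of p] \<open>p \<in> I\<close> p0 by (simp add: Ip_def abs_le_square_iff[symmetric])
  qed
  have low: "\<alpha> * cmod z powr \<beta> \<le> cmod (f z)" if z: "z \<in> \<Omega>" and q: "q \<in> I" "q < cmod z" for z q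
  proof (rule powr_bound_left[OF q(2)])
    have q0: "0 \<le> q" using q by (simp add: inI)
    then show "0 < cmod z" using q by linarith
    fix p assume p: "q < p" "p < cmod z"
    have "cmod z \<in> I" using modulus_in_nonneg_part[OF modc z] I by simp
    then have "p \<in> I" using between[of q "cmod z" p] q p by simp
    moreover have p0: "0 < p" using p q0 by linarith
    moreover have "p * p < (cmod z)\<^sup>2"
      using p p0 by (simp add: power2_eq_square mult_strict_mono')
    ultimately have "(F p)\<^sup>2 \<le> (cmod (f z))\<^sup>2" "0 < F p"
      using lower[of p p z] z pos by (auto simp: power2_eq_square)
    then show "\<alpha> * p powr \<beta> \<le> cmod (f z)"
      using pow[of p] \<open>p \<in> I\<close> p0 by (simp add: Ip_def abs_le_square_iff[symmetric])
  qed
  \<comment> \<open>The logarithmic argument does not reach 0; the bound from the right does, as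
    \<open>0 powr \<beta> = 0\<close>.\<close>
  have f0: "f 0 = 0" if "0 \<in> I"
    using up[of 0 t] that st by (simp add: inI)
  have powI: "f (of_real x) = of_real (\<alpha> * x powr \<beta>)" if x: "x \<in> I" for x
  proof (cases "x = 0")
    case False
    then have "x \<in> Ip" using x by (auto simp: Ip_def inI)
    then show ?thesis using fF[OF x] pow by simp
  qed (use f0 x in simp)
  have md: "cmod (f z) = \<alpha> * cmod z powr \<beta>" if z: "z \<in> \<Omega>" for z
  proof (cases "z \<in> of_real ` I")
    case True
    then obtain x where "x \<in> I" "z = of_real x" by blast
    then show ?thesis using powI[of x] ab by (simp add: inI norm_mult del: of_real_mult)
  next
    case False
    have r: "cmod z \<in> I" using modulus_in_nonneg_part[OF modc z] I by simp
    then have "F (cmod z) = \<alpha> * cmod z powr \<beta>" using fF[OF r] powI[OF r] by (metis of_real_eq_iff)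
    \<comment> \<open>Each alternative of \<open>off\<close> gives one inequality outright, and its
      point \<open>q\<close> lies on the side of \<open>cmod z\<close> that \<open>up\<close> or
      \<open>low\<close> needs for the other.\<close>
    then show ?thesis using off[of z] up[of z] low[of z] z False by fastforce
  qed
  have "inj_on f \<Omega>"
  proof (rule inj_onI)
    fix z w assume zw: "z \<in> \<Omega>" "w \<in> \<Omega>" "f z = f w"
    \<comment> \<open>The hypothesis \<open>inj\<close> compares only points of equal modulus; the
      modulus law reduces the general case to that one.\<close>
    then have "cmod z powr \<beta> = cmod w powr \<beta>" using md[of z] md[of w] ab by simp
    then have "cmod z = cmod w" using ab
      by (metis norm_ge_zero powr_less_mono2 linorder_neqE_linordered_idom less_irrefl)
    then show "z = w" using inj zw by blast
  qed
  then show ?thesis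
    unfolding injective_power_law_def using ab powI md cj I
    by (intro conjI exI[of _ \<alpha>] exI[of _ \<beta>] ballI) simp_all
qed

lemma pd2_of_real:
  "pd2 (of_real p) b c (of_real q) \<longleftrightarrow> 0 < p \<and> 0 < q \<and> c = cnj b \<and> (cmod b)\<^sup>2 < p * q"
  by (simp add: pd2_def)

lemma psd2_of_real:
  "psd2 (of_real p) b c (of_real q) \<longleftrightarrow> 0 \<le> p \<and> 0 \<le> q \<and> c = cnj b \<and> (cmod b)\<^sup>2 \<le> p * q"
  by (simp add: psd2_def)

lemma preserver_injective_power_law:
  assumes refl: "reflection_symmetric \<Omega>" and modc: "modulus_closed \<Omega>"
    and intv: "is_interval (nonneg_part \<Omega>)" and nsing: "\<not> is_singleton (nonneg_part \<Omega>)"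
    and H: "pd_type \<Omega> \<and> (\<forall>a\<in>\<Omega>. \<forall>b\<in>\<Omega>. \<forall>c\<in>\<Omega>. \<forall>d\<in>\<Omega>. pd2 (f a) (f b) (f c) (f d) \<longleftrightarrow> pd2 a b c d) \<or>
      psd_type \<Omega> \<and> (\<forall>a\<in>\<Omega>. \<forall>b\<in>\<Omega>. \<forall>c\<in>\<Omega>. \<forall>d\<in>\<Omega>. psd2 (f a) (f b) (f c) (f d) \<longleftrightarrow> psd2 a b c d)"
  shows "injective_power_law \<Omega> f"
proof (cases "nonneg_part \<Omega> = {}")
  case True
  \<comment> \<open>Not being a singleton still permits the empty set, and then
    \<open>\<Omega>\<close> has no point whose modulus could lie there.\<close>
  then have "\<Omega> = {}" using modulus_in_nonneg_part[OF modc] by blast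
  then show ?thesis by (simp add: injective_power_law_empty)
next
  case False
  define I where "I = nonneg_part \<Omega>"
  have inI: "x \<in> I \<longleftrightarrow> 0 \<le> x \<and> complex_of_real x \<in> \<Omega>" for x by (simp add: I_def nonneg_part_def)
  have cnj\<Omega>: "cnj z \<in> \<Omega>" if "z \<in> \<Omega>" for z using refl that by (simp add: reflection_symmetric_def)
  have modI: "cmod z \<in> I" if "z \<in> \<Omega>" for z using modulus_in_nonneg_part[OF modc that] by (simp add: I_def)
  obtain s t where st: "s \<in> I" "t \<in> I" "0 < s" "s < t"
    using ex_two_positive[OF intv nsing False] unfolding I_def nonneg_part_def by auto
  define F where "F = (\<lambda>x::real. Re (f (of_real x)))"
  have pd: "injective_power_law \<Omega> f"
    if type: "pd_type \<Omega>" and pres: "\<forall>a\<in>\<Omega>. \<forall>b\<in>\<Omega>. \<forall>c\<in>\<Omega>. \<forall>d\<in>\<Omega>. pd2 (f a) (f b) (f c) (f d) \<longleftrightarrow> pd2 a b c d"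
  proof -
    have H: "pd2 (f a) (f b) (f c) (f d) \<longleftrightarrow> pd2 a b c d"
      if "a \<in> \<Omega>" "b \<in> \<Omega>" "c \<in> \<Omega>" "d \<in> \<Omega>" for a b c d
      using pres that by blast
    have pos': "f (of_real x) \<in> \<real> \<and> 0 < F x" if x: "x \<in> I" "0 < x" for x
    proof -
      obtain q where q: "q \<in> I" "0 < q" "q \<noteq> x" using st by (cases "x = s") auto
      \<comment> \<open>Since \<open>x\<close> and \<open>q\<close> are distinct and positive, the
        square of their minimum is below \<open>x * q\<close>. This yields a positive definite
        matrix over \<open>\<Omega>\<close> with \<open>x\<close> on its diagonal.\<close>
      define m where "m = min x q"
      have "m * m < x * q" using q x
        by (cases "x < q") (auto simp: m_def min_def)
      then have "pd2 (of_real x) (of_real m) (of_real m) (of_real q)"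
        using x q by (simp add: pd2_of_real power2_eq_square)
      moreover have "of_real m \<in> \<Omega>" using x q by (auto simp: m_def min_def inI)
      ultimately have "pd2 (f (of_real x)) (f (of_real m)) (f (of_real m)) (f (of_real q))"
        using H x q by (simp add: inI)
      then show ?thesis by (simp add: pd2_def F_def)
    qed
    have fF: "f (of_real x) = of_real (F x)" if "x \<in> I" "0 < x" for x
      using pos'[OF that] by (simp add: F_def)
    have HF: "0 < F p \<and> 0 < F q \<and> (f w = cnj (f z) \<and> (cmod (f z))\<^sup>2 < F p * F q \<longleftrightarrow> w = cnj z \<and> (cmod z)\<^sup>2 < p * q)"
      if "p \<in> I" "q \<in> I" "0 < p" "0 < q" "z \<in> \<Omega>" "w \<in> \<Omega>" for p q z w
      using H[of "of_real p" z w "of_real q"] that pos'[of p] pos'[of q] fF[of p] fF[of q]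
      by (simp add: pd2_of_real inI)
    have bigger: "\<exists>q\<in>I. cmod z < q" if "z \<in> \<Omega> - of_real ` I" for z
      using type that unfolding pd_type_def I_def by (metis less_add_same_cancel1)
    have cj: "f (cnj z) = cnj (f z)" if z: "z \<in> \<Omega>" for z
    proof (cases "\<exists>q\<in>I. cmod z < q")
      case True
      then obtain q where q: "q \<in> I" "cmod z < q" by blast
      then have "0 < q" using norm_ge_zero[of z] by linarith
      moreover have "(cmod z)\<^sup>2 < q * q" using q by (simp add: power2_eq_square mult_strict_mono')
      ultimately show ?thesis using HF[of q q z "cnj z"] q z cnj\<Omega>[OF z] by blast
    next
      case False
      \<comment> \<open>Without a larger diagonal entry, pd-type leaves only a point of
        \<open>I\<close>. It is an upper bound of \<open>I\<close>, hence positive, and its value is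
        already known to be real.\<close>
      then obtain x where x: "x \<in> I" "z = of_real x" using bigger z by blast
      have "0 \<le> x" using x by (simp add: inI)
      then have "t \<le> x" using False x st by (auto simp: not_less)
      then have "0 < x" using st by simp
      then show ?thesis using fF x by simp
    qed
    have HF': "(cmod (f z))\<^sup>2 < F p * F q \<longleftrightarrow> (cmod z)\<^sup>2 < p * q"
      if "p \<in> I" "q \<in> I" "0 < p" "0 < q" "z \<in> \<Omega>" for p q z
      using HF[of p q z "cnj z"] that cj cnj\<Omega> by blast
    show ?thesis
    proof (rule injective_power_lawI[OF modc intv[folded I_def] I_def st])
      show "0 < Re (f (of_real x))" if "x \<in> I" "0 < x" for x using pos'[OF that] by (simp add: F_def)
      show "f (cnj z) = cnj (f z)" if "z \<in> \<Omega>" for z by (rule cj[OF that])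
      have "(F s)\<^sup>2 < F s * F t"
        using HF'[of s t "of_real s"] st fF[of s] by (simp add: inI power2_eq_square norm_mult)
      then show "Re (f (of_real s)) < Re (f (of_real t))"
        using pos'[of s] st by (simp add: F_def power2_eq_square)
    next
      fix p q z assume a: "p \<in> I" "q \<in> I" "0 < p" "0 < q" "z \<in> \<Omega>"
      show "(cmod (f z))\<^sup>2 \<le> Re (f (of_real p)) * Re (f (of_real q))" if "(cmod z)\<^sup>2 < p * q"
        using HF'[OF a] that by (simp add: F_def)
      show "Re (f (of_real p)) * Re (f (of_real q)) \<le> (cmod (f z))\<^sup>2" if "p * q < (cmod z)\<^sup>2"
        using HF'[OF a] that by (simp add: F_def)
    next
      fix z assume z: "z \<in> \<Omega> - of_real ` I"
      have r: "cmod z \<in> I" using z modI by simp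
      have "z \<noteq> 0" using z r by (auto simp: image_iff inI dest: bspec[of _ _ 0])
      \<comment> \<open>The matrix with diagonal \<open>cmod z, cmod z\<close> and off-diagonal
        \<open>z\<close> is singular, so neither it nor its image is positive definite.\<close>
      then have "(F (cmod z))\<^sup>2 \<le> (cmod (f z))\<^sup>2"
        using HF'[of "cmod z" "cmod z" z] r z by (simp add: power2_eq_square not_less)
      then have "F (cmod z) \<le> cmod (f z)" by (rule power2_le_imp_le) simp
      then show "(Re (f (of_real (cmod z))) \<le> cmod (f z) \<and> (\<exists>q\<in>I. cmod z < q)) \<or>
        (cmod (f z) \<le> Re (f (of_real (cmod z))) \<and> (\<exists>q\<in>I. q < cmod z))"
        using bigger[OF z] by (simp add: F_def)
    next
      fix z w assume zw: "z \<in> \<Omega>" "w \<in> \<Omega>" "cmod z = cmod w" "f z = f w"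
      show "z = w"
      proof (cases "\<exists>q\<in>I. cmod z < q")
        case True
        then obtain q where q: "q \<in> I" "cmod z < q" by blast
        then have q0: "0 < q" using norm_ge_zero[of z] by linarith
        moreover have "(cmod z)\<^sup>2 < q * q" using q by (simp add: power2_eq_square mult_strict_mono')
        moreover have "f (cnj w) = cnj (f z)" using cj zw by simp
        ultimately have "cnj w = cnj z" 
          using HF'[of q q z] HF[of q q z "cnj w"] q zw cnj\<Omega>[of w] by blast
        then show ?thesis by simp
      next
        case False
        \<comment> \<open>No strict test matrix is available here, but nonnegative reals of equal
          modulus coincide.\<close>
        then have "z \<in> of_real ` I" "w \<in> of_real ` I" using bigger[of z] bigger[of w] zw by auto
        then show ?thesis using zw by (auto simp: inI)
      qed
    qed
  qed
  have psd: "injective_power_law \<Omega> f"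
    if type: "psd_type \<Omega>" and pres: "\<forall>a\<in>\<Omega>. \<forall>b\<in>\<Omega>. \<forall>c\<in>\<Omega>. \<forall>d\<in>\<Omega>. psd2 (f a) (f b) (f c) (f d) \<longleftrightarrow> psd2 a b c d"
  proof -
    have H: "psd2 (f a) (f b) (f c) (f d) \<longleftrightarrow> psd2 a b c d"
      if "a \<in> \<Omega>" "b \<in> \<Omega>" "c \<in> \<Omega>" "d \<in> \<Omega>" for a b c d
      using pres that by blast
    have nonneg: "f (of_real x) \<in> \<real> \<and> 0 \<le> F x" if x: "x \<in> I" for x
    proof -
      have "psd2 (of_real x) (of_real x) (of_real x) (of_real x)"
        using x by (simp add: psd2_of_real inI power2_eq_square)
      then have "psd2 (f (of_real x)) (f (of_real x)) (f (of_real x)) (f (of_real x))"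
        using H x by (simp add: inI)
      then show ?thesis by (simp add: psd2_def F_def)
    qed
    have fF: "f (of_real x) = of_real (F x)" if "x \<in> I" for x
      using nonneg[OF that] by (simp add: F_def)
    have HF: "f w = cnj (f z) \<and> (cmod (f z))\<^sup>2 \<le> F p * F q \<longleftrightarrow> w = cnj z \<and> (cmod z)\<^sup>2 \<le> p * q"
      if "p \<in> I" "q \<in> I" "z \<in> \<Omega>" "w \<in> \<Omega>" for p q z w
      using H[of "of_real p" z w "of_real q"] that nonneg[of p] nonneg[of q] fF[of p] fF[of q]
      by (simp add: psd2_of_real inI)
    have smaller: "\<exists>q\<in>I. q < cmod z" if "z \<in> \<Omega> - of_real ` I" for z
      using type that unfolding psd_type_def I_def by (metis diff_less_eq less_add_same_cancel1)
    have cj: "f (cnj z) = cnj (f z)" if z: "z \<in> \<Omega>" for z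
      using HF[of "cmod z" "cmod z" z "cnj z"] modI[OF z] z cnj\<Omega>[OF z]
      by (simp add: power2_eq_square)
    have HF': "(cmod (f z))\<^sup>2 \<le> F p * F q \<longleftrightarrow> (cmod z)\<^sup>2 \<le> p * q"
      if "p \<in> I" "q \<in> I" "z \<in> \<Omega>" for p q z
      using HF[of p q z "cnj z"] that cj cnj\<Omega> by blast
    have HI: "(F y)\<^sup>2 \<le> F p * F q \<longleftrightarrow> y\<^sup>2 \<le> p * q" if "p \<in> I" "q \<in> I" "y \<in> I" for p q y
      using HF'[of p q "of_real y"] that fF[of y] by (simp add: inI)
    have strict: "F p < F q" if "p \<in> I" "q \<in> I" "p < q" for p q
    proof -
      \<comment> \<open>Off-diagonal \<open>q\<close> with diagonal \<open>p, p\<close> is not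
        positive semidefinite; the strict inequality passes to \<open>F\<close> by
        contraposition.\<close>
      have "p * p < q\<^sup>2" using that by (simp add: inI power2_eq_square mult_strict_mono')
      then have "(F p)\<^sup>2 < (F q)\<^sup>2" using HI[of p p q] that by (simp add: power2_eq_square)
      then show ?thesis by (rule power2_less_imp_less) (use nonneg that in blast)
    qed
    have pos: "0 < F x" if x: "x \<in> I" "0 < x" for x
    proof (cases "s < x")
      case True
      then show ?thesis using strict[of s x] nonneg[of s] st x by simp
    next
      case False
      then have xt: "x < t" using st by simp
      \<comment> \<open>If \<open>x\<close> is the minimum of \<open>I\<close>, then \<open>strict\<close> does not exclude \<open>F x = 0\<close>; the geometric mean of
        \<open>x\<close> and \<open>t\<close> does.\<close>
      define y where "y = sqrt (x * t)"
      have y2: "y\<^sup>2 = x * t" using x xt by (simp add: y_def)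
      have "x < y" by (rule power2_less_imp_less) (use x xt y2 in \<open>auto simp: power2_eq_square y_def\<close>)
      have "y < t" by (rule power2_less_imp_less) (use x xt y2 in \<open>auto simp: power2_eq_square y_def\<close>)
      have y: "y \<in> I" using intv x st \<open>x < y\<close> \<open>y < t\<close> unfolding I_def is_interval_1
        by (meson less_imp_le)
      have "0 < (F y)\<^sup>2" using strict[OF x(1) y \<open>x < y\<close>] nonneg[OF x(1)] by simp
      also have "\<dots> \<le> F x * F t" using HI[of x t y] x st y y2 by simp
      finally show ?thesis using nonneg[OF x(1)] by (cases "F x = 0") auto
    qed
    show ?thesis
    proof (rule injective_power_lawI[OF modc intv[folded I_def] I_def st])
      show "0 < Re (f (of_real x))" if "x \<in> I" "0 < x" for x using pos[OF that] by (simp add: F_def)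
      show "f (cnj z) = cnj (f z)" if "z \<in> \<Omega>" for z by (rule cj[OF that])
      show "Re (f (of_real s)) < Re (f (of_real t))"
        using strict[of s t] st by (simp add: F_def)
    next
      fix p q z assume a: "p \<in> I" "q \<in> I" "0 < p" "0 < q" "z \<in> \<Omega>"
      show "(cmod (f z))\<^sup>2 \<le> Re (f (of_real p)) * Re (f (of_real q))" if "(cmod z)\<^sup>2 < p * q"
        using HF'[OF a(1,2,5)] that by (simp add: F_def)
      show "Re (f (of_real p)) * Re (f (of_real q)) \<le> (cmod (f z))\<^sup>2" if "p * q < (cmod z)\<^sup>2"
        using HF'[OF a(1,2,5)] that by (simp add: F_def)
    next
      fix z assume z: "z \<in> \<Omega> - of_real ` I"
      have r: "cmod z \<in> I" using z modI by simp
      \<comment> \<open>The singular matrix with diagonal \<open>cmod z, cmod z\<close> is now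
        positive semidefinite, so the inequality is the reverse of the one in the definite
        case.\<close>
      then have "(cmod (f z))\<^sup>2 \<le> (F (cmod z))\<^sup>2"
        using HF'[of "cmod z" "cmod z" z] r z by (simp add: power2_eq_square)
      then have "cmod (f z) \<le> F (cmod z)" by (rule power2_le_imp_le) (use nonneg r in blast)
      then show "(Re (f (of_real (cmod z))) \<le> cmod (f z) \<and> (\<exists>q\<in>I. cmod z < q)) \<or>
        (cmod (f z) \<le> Re (f (of_real (cmod z))) \<and> (\<exists>q\<in>I. q < cmod z))"
        using smaller[OF z] by (simp add: F_def)
    next
      fix z w assume zw: "z \<in> \<Omega>" "w \<in> \<Omega>" "cmod z = cmod w" "f z = f w"
      have "f (cnj w) = cnj (f z)" using cj zw by simp
      moreover have "(cmod z)\<^sup>2 \<le> cmod z * cmod z" by (simp add: power2_eq_square)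
      ultimately have "cnj w = cnj z"
        using HF'[of "cmod z" "cmod z" z] HF[of "cmod z" "cmod z" z "cnj w"] modI zw cnj\<Omega>[of w]
        by blast
      then show "z = w" by simp
    qed
  qed
  show ?thesis using H pd psd by blast
qed

section \<open>Injective power laws preserve definiteness, and the equivalence\<close>

lemma powr_less_iff_less_base:
  fixes x y \<beta> :: real
  assumes "0 < \<beta>" "0 \<le> x" "0 \<le> y"
  shows "x powr \<beta> < y powr \<beta> \<longleftrightarrow> x < y"
  using assms powr_less_mono2[of \<beta> x y] powr_mono2[of \<beta> y x] by linarith

lemma powr_le_iff_le_base:
  fixes x y \<beta> :: real
  assumes "0 < \<beta>" "0 \<le> x" "0 \<le> y"
  shows "x powr \<beta> \<le> y powr \<beta> \<longleftrightarrow> x \<le> y"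
  using assms powr_less_iff_less_base[of \<beta> y x] by linarith

text \<open>Each entrywise condition is both preserved and reflected: injectivity handles
  nonnegative diagonals and \<open>c = cnj b\<close>, and both sides of the determinant inequality
  pass through the increasing map sending \<open>u\<close> to
  \<open>\<alpha>\<^sup>2 * u powr \<beta>\<close> on the nonnegative reals.\<close>

lemma injective_power_law_preserves:
  assumes refl: "reflection_symmetric \<Omega>" and modc: "modulus_closed \<Omega>"
    and f: "injective_power_law \<Omega> f"
    and \<Omega>: "a \<in> \<Omega>" "b \<in> \<Omega>" "c \<in> \<Omega>" "d \<in> \<Omega>"
  shows "(pd2 (f a) (f b) (f c) (f d) \<longleftrightarrow> pd2 a b c d) \<and>
    (psd2 (f a) (f b) (f c) (f d) \<longleftrightarrow> psd2 a b c d)"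
proof -
  obtain \<alpha> \<beta> :: real where ab: "0 < \<alpha>" "0 < \<beta>"
    and pos: "\<And>r. r \<in> nonneg_part \<Omega> \<Longrightarrow> f (of_real r) = of_real (\<alpha> * r powr \<beta>)"
    and md: "\<And>z. z \<in> \<Omega> \<Longrightarrow> cmod (f z) = \<alpha> * cmod z powr \<beta>"
    and cj: "\<And>z. z \<in> \<Omega> \<Longrightarrow> f (cnj z) = cnj (f z)"
    and inj: "inj_on f \<Omega>"
    using f unfolding injective_power_law_def by blast
  have nonneg_iff: "f z \<in> \<real> \<and> 0 \<le> Re (f z) \<longleftrightarrow> z \<in> \<real> \<and> 0 \<le> Re z" if z: "z \<in> \<Omega>" for z
  proof
    have r: "cmod z \<in> nonneg_part \<Omega>" using modulus_in_nonneg_part[OF modc z] .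
    assume "f z \<in> \<real> \<and> 0 \<le> Re (f z)"
    \<comment> \<open>A nonnegative real value at \<open>z\<close> is also the value at
      \<open>cmod z\<close>, so injectivity identifies the two points.\<close>
    then have "f z = of_real (cmod (f z))" by (auto elim!: Reals_cases)
    also have "\<dots> = f (of_real (cmod z))" using pos[OF r] md[OF z] by simp
    finally have "z = of_real (cmod z)"
      using inj z r by (auto simp: nonneg_part_def dest: inj_onD)
    then show "z \<in> \<real> \<and> 0 \<le> Re z"
      by (metis Re_complex_of_real Reals_of_real norm_ge_zero)
  next
    assume "z \<in> \<real> \<and> 0 \<le> Re z"
    then obtain r where "z = of_real r" "0 \<le> r" by (auto elim!: Reals_cases)
    then show "f z \<in> \<real> \<and> 0 \<le> Re (f z)"
      using pos[of r] z ab by (simp add: nonneg_part_def del: of_real_mult)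
  qed
  have cnj_iff: "f c = cnj (f b) \<longleftrightarrow> c = cnj b"
  proof
    have "cnj b \<in> \<Omega>" using refl \<Omega> by (simp add: reflection_symmetric_def)
    moreover assume "f c = cnj (f b)"
    then have "f c = f (cnj b)" using cj \<Omega> by simp
    ultimately show "c = cnj b" using inj \<Omega> by (blast dest: inj_onD)
  qed (use cj \<Omega> in simp)
  have val: "Re (f (of_real x)) = \<alpha> * x powr \<beta>" if "of_real x \<in> \<Omega>" "0 \<le> x" for x :: real
    using pos[of x] that by (simp add: nonneg_part_def del: of_real_mult)
  have norm_b: "(cmod (f b))\<^sup>2 = \<alpha>\<^sup>2 * ((cmod b)\<^sup>2) powr \<beta>"
    unfolding md[OF \<Omega>(2)] by (simp add: power_mult_distrib power2_eq_square powr_mult)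
  have prod: "Re (f (of_real x)) * Re (f (of_real y)) = \<alpha>\<^sup>2 * (x * y) powr \<beta>"
    if "of_real x \<in> \<Omega>" "of_real y \<in> \<Omega>" "0 \<le> x" "0 \<le> y" for x y :: real
    using that by (simp add: val power2_eq_square powr_mult)
  have less_iff: "(cmod (f b))\<^sup>2 < Re (f (of_real x)) * Re (f (of_real y)) \<longleftrightarrow> (cmod b)\<^sup>2 < x * y"
    if "of_real x \<in> \<Omega>" "of_real y \<in> \<Omega>" "0 \<le> x" "0 \<le> y" for x y :: real
    unfolding norm_b prod[OF that] using ab that by (simp add: powr_less_iff_less_base)
  have le_iff: "(cmod (f b))\<^sup>2 \<le> Re (f (of_real x)) * Re (f (of_real y)) \<longleftrightarrow> (cmod b)\<^sup>2 \<le> x * y"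
    if "of_real x \<in> \<Omega>" "of_real y \<in> \<Omega>" "0 \<le> x" "0 \<le> y" for x y :: real
    unfolding norm_b prod[OF that] using ab that by (simp add: powr_le_iff_le_base)
  have psd2_alt: "psd2 a b c d \<longleftrightarrow> (a \<in> \<real> \<and> 0 \<le> Re a) \<and> (d \<in> \<real> \<and> 0 \<le> Re d) \<and> c = cnj b \<and> (cmod b)\<^sup>2 \<le> Re a * Re d"
    for a b c d by (auto simp: psd2_def)
  have pd2_alt: "pd2 a b c d \<longleftrightarrow> (a \<in> \<real> \<and> 0 \<le> Re a) \<and> (d \<in> \<real> \<and> 0 \<le> Re d) \<and> c = cnj b \<and> (cmod b)\<^sup>2 < Re a * Re d"
    for a b c d
  proof -
    \<comment> \<open>A positive product of nonnegative diagonal entries makes both positive, so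
      \<open>nonneg_iff\<close> serves the definite case too.\<close>
    have "0 < Re a \<and> 0 < Re d" if "0 \<le> Re a" "0 \<le> Re d" "(cmod b)\<^sup>2 < Re a * Re d"
      using that le_less_trans[OF zero_le_power2 that(3)] by (auto simp: zero_less_mult_iff)
    then show ?thesis by (auto simp: pd2_def)
  qed
  have "psd2 (f a) (f b) (f c) (f d) \<longleftrightarrow> psd2 a b c d"
    unfolding psd2_alt nonneg_iff[OF \<Omega>(1)] nonneg_iff[OF \<Omega>(4)] cnj_iff
    using le_iff[of "Re a" "Re d"] \<Omega> by auto
  moreover have "pd2 (f a) (f b) (f c) (f d) \<longleftrightarrow> pd2 a b c d"
    unfolding pd2_alt nonneg_iff[OF \<Omega>(1)] nonneg_iff[OF \<Omega>(4)] cnj_iff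
    using less_iff[of "Re a" "Re d"] \<Omega> by auto
  ultimately show ?thesis by blast
qed

text \<open>One-point intervals are excluded because over \<open>\<Omega> = {1}\<close> no matrix is
  positive definite, so \<open>f 1 = -1\<close> would pass the definite test without being a signed
  power.\<close>

theorem theorem3p1:
  fixes \<Omega> :: "complex set" and f :: "complex \<Rightarrow> complex"
  assumes "reflection_symmetric \<Omega>"
    and "modulus_closed \<Omega>"
    and "is_interval (nonneg_part \<Omega>)"
    and "\<not> is_singleton (nonneg_part \<Omega>)"
  shows "(pd_type \<Omega> \<longrightarrow>
            ((\<forall>A \<in> (matrices_over \<Omega> :: (complex^2^2) set).
                positive_definite (map_matrix f A) \<longleftrightarrow> positive_definite A)
             \<longleftrightarrow> signed_power_like \<Omega> f))
       \<and> (psd_type \<Omega> \<longrightarrow>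
            ((\<forall>A \<in> (matrices_over \<Omega> :: (complex^2^2) set).
                positive_semidefinite (map_matrix f A) \<longleftrightarrow> positive_semidefinite A)
             \<longleftrightarrow> signed_power_like \<Omega> f))"
proof -
  have entry: "map_matrix f A $ i $ j = f (A $ i $ j)" for A :: "complex^2^2" and i j
    by (simp add: map_matrix_def)
  have pd: "(\<forall>A \<in> (matrices_over \<Omega> :: (complex^2^2) set).
      positive_definite (map_matrix f A) \<longleftrightarrow> positive_definite A) \<longleftrightarrow>
    (\<forall>a\<in>\<Omega>. \<forall>b\<in>\<Omega>. \<forall>c\<in>\<Omega>. \<forall>d\<in>\<Omega>. pd2 (f a) (f b) (f c) (f d) \<longleftrightarrow> pd2 a b c d)"
    unfolding definiteness_2[THEN conjunct1] entry by (rule ball_matrices_over_2)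
  have psd: "(\<forall>A \<in> (matrices_over \<Omega> :: (complex^2^2) set).
      positive_semidefinite (map_matrix f A) \<longleftrightarrow> positive_semidefinite A) \<longleftrightarrow>
    (\<forall>a\<in>\<Omega>. \<forall>b\<in>\<Omega>. \<forall>c\<in>\<Omega>. \<forall>d\<in>\<Omega>. psd2 (f a) (f b) (f c) (f d) \<longleftrightarrow> psd2 a b c d)"
    unfolding definiteness_2[THEN conjunct2] entry by (rule ball_matrices_over_2)
  show ?thesis
    unfolding pd psd signed_power_like_iff[OF assms(1,2)]
  proof (intro conjI impI iffI)
    assume "pd_type \<Omega>"
      and "\<forall>a\<in>\<Omega>. \<forall>b\<in>\<Omega>. \<forall>c\<in>\<Omega>. \<forall>d\<in>\<Omega>. pd2 (f a) (f b) (f c) (f d) \<longleftrightarrow> pd2 a b c d"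
    then show "injective_power_law \<Omega> f"
      by (intro preserver_injective_power_law[OF assms]) blast
  next
    assume "psd_type \<Omega>"
      and "\<forall>a\<in>\<Omega>. \<forall>b\<in>\<Omega>. \<forall>c\<in>\<Omega>. \<forall>d\<in>\<Omega>. psd2 (f a) (f b) (f c) (f d) \<longleftrightarrow> psd2 a b c d"
    then show "injective_power_law \<Omega> f"
      by (intro preserver_injective_power_law[OF assms]) blast
  qed (use injective_power_law_preserves[OF assms(1,2)] in auto)
qed

end
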